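(* Let $n\ge 1$ and let $x,y\in\mathfrak{S}_n$. Then $$x\unrhd_R y \quad\iff\quad [y(i),x(i)]\subseteq y[i,n]\quad\text{for all } i\in[n].$$
   Context: Notation: $[m,n]=\{m,\dots,n\}$ is an integer interval (empty if $m>n$), $[n]=[1,n]$; for a permutation $y$, $y[i,n]=\{y(i),y(i+1),\dots,y(n)\}$. For $a,b\in\mathbb{Z}^n$, $a\leq_C b$ means $a(i)\leq b(i)$ for all $i$. For $x\in[n]^n$ the conjugate is $x^*=(n+1-x(n),\dots,n+1-x(1))$. $\mathfrak{S}_n$ is the group of permutations of $[n]$. Parking functions: cars $1,\dots,n$ enter, in this order, a one-way street with spots $1,\dots,n$. Given $a\in[n]^n$, car $i$ parks in the first (lowest-numbered) available spot in $[a(i),n]$; if there is none, the procedure fails. If all cars park, $a$ is a parking function, and its outcome is the permutation $\mathcal{O}(a)=w\in\mathfrak{S}_n$, where car $i$ parks in spot $w(i)$. Interval parking functions (IPFs): given $a,b\in[n]^n$ with $a\leq_C b$, car $i$ parks in the first available spot in $[a(i),b(i)]$; if there is none, the procedure fails. If all cars park, $(a,b)$ is an interval parking function. If $(a,b)$ is an IPF, then both $a$ and $b^*$ are parking functions. Reachability: for $x,y\in\mathfrak{S}_n$, the pair $(x,y)$ is reachable, written $x\unrhd_R y$, if there exists an IPF $(a,b)$ with $x=\mathcal{O}(a)$ and $y=\mathcal{O}(b^* )^*$. *)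

theory Defs
  imports "HOL-Combinatorics.Permutations" "HOL-Library.FuncSet"
begin

text \<open>
  A tuple in $[n]^n$ is a function \<open>nat \<Rightarrow> nat\<close> mapping \<open>{1..n}\<close> to \<open>{1..n}\<close>; its values outside
  \<open>{1..n}\<close> never matter. A permutation of $[n]$ is a function that \<open>permutes {1..n}\<close>, so it is the
  identity outside \<open>{1..n}\<close>. Outcomes and conjugates below are also the identity there, so that
  equality with a permutation means equality of the tuples.
\<close>

definition conjugate :: "nat \<Rightarrow> (nat \<Rightarrow> nat) \<Rightarrow> nat \<Rightarrow> nat" where
  "conjugate n x = (\<lambda>i. if i \<in> {1..n} then n + 1 - x (n + 1 - i) else i)"

text \<open>
  The state after cars \<open>1, \<dots>, k\<close> have entered, where car \<open>i\<close> takes the lowest-numbered spot of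
  \<open>{a i..b i}\<close> not taken by an earlier car: \<open>Some w\<close> if all of them park, car \<open>i\<close> in spot \<open>w i\<close>
  (and \<open>w i = i\<close> for the cars \<open>i\<close> that have not entered), or \<open>None\<close> if some car fails to park.
\<close>

primrec park :: "(nat \<Rightarrow> nat) \<Rightarrow> (nat \<Rightarrow> nat) \<Rightarrow> nat \<Rightarrow> (nat \<Rightarrow> nat) option" where
  "park a b 0 = Some id"
| "park a b (Suc k) =
     (case park a b k of
        None \<Rightarrow> None
      | Some w \<Rightarrow>
          (let avail = {a (Suc k)..b (Suc k)} - w ` {1..k}
           in if avail = {} then None else Some (w(Suc k := Min avail))))"

definition outcome :: "nat \<Rightarrow> (nat \<Rightarrow> nat) \<Rightarrow> (nat \<Rightarrow> nat) option" where
  "outcome n a = park a (\<lambda>_. n) n"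

definition interval_parking_function :: "nat \<Rightarrow> (nat \<Rightarrow> nat) \<Rightarrow> (nat \<Rightarrow> nat) \<Rightarrow> bool" where
  "interval_parking_function n a b \<longleftrightarrow>
     a \<in> {1..n} \<rightarrow> {1..n} \<and> b \<in> {1..n} \<rightarrow> {1..n} \<and> (\<forall>i\<in>{1..n}. a i \<le> b i) \<and> park a b n \<noteq> None"

text \<open>
  The two equations say that \<open>a\<close> and \<open>conjugate n b\<close> are parking functions, which is automatic for
  an interval parking function \<open>(a, b)\<close>, and that $x = \mathcal{O}(a)$ and
  $y = \mathcal{O}(b^*)^*$.
\<close>

definition reachable :: "nat \<Rightarrow> (nat \<Rightarrow> nat) \<Rightarrow> (nat \<Rightarrow> nat) \<Rightarrow> bool" where
  "reachable n x y \<longleftrightarrow>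
     (\<exists>a b. interval_parking_function n a b \<and>
        outcome n a = Some x \<and>
        map_option (conjugate n) (outcome n (conjugate n b)) = Some y)"

end

theory Submission
  imports Defs
begin

text \<open>
  Both conditions on a pair \<open>(a, b)\<close> in the definition of reachability decouple into conditions on
  each car. A car takes the lowest free spot of its interval exactly if that spot lies in the
  interval, is free, and every lower spot of the interval is occupied (\<open>park_eq_Some_iff\<close>).
  Two consequences carry the proof.

  First, an interval parking function \<open>(a, b)\<close> parks its cars exactly where \<open>a\<close> alone would: the
  upper ends \<open>b\<close> never change where a car goes, they can only make it fail. Hence \<open>(a, b)\<close> is an
  interval parking function with $\mathcal{O}(a) = x$ if and only if $\mathcal{O}(a) = x$ and
  \<open>x i \<le> b i\<close> for all \<open>i\<close>.

  Second, conjugation reverses both the street and the order of the cars. So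
  $\mathcal{O}(b^*)^* = y$ says that the cars \<open>n, \<dots>, 1\<close>, entering in this order, each take the
  highest free spot that is at most \<open>b i\<close>. Equivalently, \<open>y i \<le> b i\<close>, and the spots above \<open>y i\<close> up to
  \<open>b i\<close> are all occupied by cars with a larger number than \<open>i\<close>.

  If \<open>(x, y)\<close> is reachable, then \<open>x i \<le> b i\<close>, so the interval from \<open>y i\<close> to \<open>x i\<close> is part of the one
  from \<open>y i\<close> to \<open>b i\<close>, whose spots all belong to \<open>y ` {i..n}\<close>. Conversely, \<open>a = x\<close> and the smallest
  candidate \<open>b i = max (x i) (y i)\<close> witness reachability.
\<close>

section \<open>The outcome of the parking procedure\<close>

lemma Min_eq_first_iff:
  fixes A :: "nat set"
  assumes "finite A"
  shows "A \<noteq> {} \<and> m = Min A \<longleftrightarrow> m \<in> A \<and> (\<forall>s\<in>A. m \<le> s)"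
  using assms by (metis Min_eq_iff empty_iff)

text \<open>
  The procedure is deterministic, so checking each car against the earlier ones pins down the whole
  final state; this replaces the recursion by a condition on each car.
\<close>

lemma park_eq_Some_iff:
  "park a b k = Some w \<longleftrightarrow>
     (\<forall>i. i \<notin> {1..k} \<longrightarrow> w i = i) \<and>
     (\<forall>i\<in>{1..k}. w i \<in> {a i..b i} \<and> w i \<notin> w ` {1..<i} \<and> {a i..<w i} \<subseteq> w ` {1..<i})"
proof (induction k arbitrary: w)
  case 0
  show ?case by (auto simp: fun_eq_iff)
next
  case (Suc k)
  let ?parks = "\<lambda>w i. w i \<in> {a i..b i} \<and> w i \<notin> w ` {1..<i} \<and> {a i..<w i} \<subseteq> w ` {1..<i}"
  let ?rest = "\<lambda>w k. \<forall>i. i \<notin> {1..k} \<longrightarrow> w i = (i::nat)"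
  \<comment> \<open>The only possible state before the last car: cars that have not entered map to themselves.\<close>
  define v where "v = w(Suc k := Suc k)"
  let ?avail = "\<lambda>u. {a (Suc k)..b (Suc k)} - u ` {1..k}"
  have image_v: "v ` {1..<i} = w ` {1..<i}" if "i \<le> Suc k" for i
    using that by (intro image_cong) (auto simp: v_def)
  have v_image: "v ` {1..k} = w ` {1..k}"
    by (intro image_cong) (auto simp: v_def)
  have parks_v: "?parks v i = ?parks w i" if "i \<in> {1..k}" for i
    using image_v[of i] that by (simp add: v_def)
  have rest_v: "?rest v k \<longleftrightarrow> ?rest w (Suc k)"
    by (auto simp: v_def)
  have previous: "u = v" if "park a b k = Some u" "w = u(Suc k := m)" for u m
    using that Suc.IH[of u] by (auto simp: v_def fun_eq_iff)
  have "park a b (Suc k) = Some w \<longleftrightarrow>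
      (\<exists>u. park a b k = Some u \<and> ?avail u \<noteq> {} \<and> w = u(Suc k := Min (?avail u)))"
    by (auto split: option.splits simp: Let_def)
  also have "\<dots> \<longleftrightarrow> park a b k = Some v \<and> ?avail v \<noteq> {} \<and> w (Suc k) = Min (?avail v)"
  proof
    assume "\<exists>u. park a b k = Some u \<and> ?avail u \<noteq> {} \<and> w = u(Suc k := Min (?avail u))"
    then obtain u where u: "park a b k = Some u" "?avail u \<noteq> {}" "w = u(Suc k := Min (?avail u))"
      by blast
    from u(1,3) have "u = v" by (rule previous)
    moreover from u(3) have "w (Suc k) = Min (?avail u)" by (metis fun_upd_same)
    ultimately show "park a b k = Some v \<and> ?avail v \<noteq> {} \<and> w (Suc k) = Min (?avail v)"
      using u(1,2) by simp
  next
    assume v: "park a b k = Some v \<and> ?avail v \<noteq> {} \<and> w (Suc k) = Min (?avail v)"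
    have "w = v(Suc k := w (Suc k))" by (simp add: v_def)
    with v show "\<exists>u. park a b k = Some u \<and> ?avail u \<noteq> {} \<and> w = u(Suc k := Min (?avail u))"
      by metis
  qed
  also have "\<dots> \<longleftrightarrow> park a b k = Some v \<and> ?parks w (Suc k)"
  proof -
    have "?avail v \<noteq> {} \<and> w (Suc k) = Min (?avail v) \<longleftrightarrow>
        w (Suc k) \<in> ?avail v \<and> (\<forall>s\<in>?avail v. w (Suc k) \<le> s)"
      by (rule Min_eq_first_iff) simp
    also have "\<dots> \<longleftrightarrow> ?parks w (Suc k)"
    proof -
      have "(\<forall>s\<in>?avail v. w (Suc k) \<le> s) \<longleftrightarrow> {a (Suc k)..<w (Suc k)} \<subseteq> w ` {1..k}"
        if "w (Suc k) \<le> b (Suc k)"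
      proof
        assume "\<forall>s\<in>?avail v. w (Suc k) \<le> s"
        with that show "{a (Suc k)..<w (Suc k)} \<subseteq> w ` {1..k}"
          unfolding v_image by (meson DiffI atLeastAtMost_iff atLeastLessThan_iff leD
              less_imp_le order_trans subsetI)
      next
        assume below: "{a (Suc k)..<w (Suc k)} \<subseteq> w ` {1..k}"
        show "\<forall>s\<in>?avail v. w (Suc k) \<le> s"
        proof
          fix s assume s: "s \<in> ?avail v"
          show "w (Suc k) \<le> s"
          proof (rule leI, rule notI)
            assume "s < w (Suc k)"
            with s have "s \<in> {a (Suc k)..<w (Suc k)}" by simp
            with below s show False unfolding v_image by blast
          qed
        qed
      qed
      then show ?thesis
        unfolding v_image atLeastLessThanSuc_atLeastAtMost Diff_iff atLeastAtMost_iff by blast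
    qed
    finally show ?thesis by blast
  qed
  also have "\<dots> \<longleftrightarrow> ?rest w (Suc k) \<and> (\<forall>i\<in>{1..k}. ?parks w i) \<and> ?parks w (Suc k)"
    unfolding Suc.IH[of v] rest_v using parks_v by blast
  also have "\<dots> \<longleftrightarrow> ?rest w (Suc k) \<and> (\<forall>i\<in>{1..Suc k}. ?parks w i)"
    by (auto simp: atLeastAtMostSuc_conv)
  finally show ?case .
qed

lemma outcome_eq_Some_iff:
  assumes "x permutes {1..n}"
  shows "outcome n a = Some x \<longleftrightarrow> (\<forall>i\<in>{1..n}. a i \<le> x i \<and> {a i..<x i} \<subseteq> x ` {1..<i})"
proof -
  have "x i \<notin> x ` {1..<i}" for i
    by (simp add: inj_image_mem_iff[OF permutes_inj[OF assms]])
  moreover have "x i \<le> n" if "i \<in> {1..n}" for i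
    using permutes_in_image[OF assms, of i] that by simp
  moreover have "x i = i" if "i \<notin> {1..n}" for i
    using permutes_not_in[OF assms that] .
  ultimately show ?thesis
    unfolding outcome_def park_eq_Some_iff by auto
qed

text \<open>
  A car that finds a spot in its interval would take the same spot if its interval were extended to
  the end of the street, so only the inequalities \<open>x i \<le> b i\<close> separate the two procedures.
\<close>

lemma interval_parking_function_with_outcome_iff:
  assumes "a \<in> {1..n} \<rightarrow> {1..n}" and b: "b \<in> {1..n} \<rightarrow> {1..n}"
  shows "interval_parking_function n a b \<and> outcome n a = Some x \<longleftrightarrow>
         outcome n a = Some x \<and> (\<forall>i\<in>{1..n}. x i \<le> b i)"
proof
  assume lhs: "interval_parking_function n a b \<and> outcome n a = Some x"
  then obtain w where w: "park a b n = Some w"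
    by (auto simp: interval_parking_function_def)
  have "b i \<le> n" if "i \<in> {1..n}" for i
    using b that by (auto simp: Pi_iff)
  with w have "outcome n a = Some w"
    unfolding outcome_def park_eq_Some_iff by fastforce
  with lhs have "w = x" by simp
  with w lhs show "outcome n a = Some x \<and> (\<forall>i\<in>{1..n}. x i \<le> b i)"
    by (simp add: park_eq_Some_iff)
next
  assume rhs: "outcome n a = Some x \<and> (\<forall>i\<in>{1..n}. x i \<le> b i)"
  then have "park a b n = Some x"
    unfolding outcome_def park_eq_Some_iff by simp
  moreover from this have "\<forall>i\<in>{1..n}. a i \<le> b i"
    unfolding park_eq_Some_iff by fastforce
  ultimately show "interval_parking_function n a b \<and> outcome n a = Some x"
    using rhs assms by (simp add: interval_parking_function_def)
qed

section \<open>Conjugation\<close>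

lemma conjugate_conjugate:
  assumes "\<And>i. i \<in> {1..n} \<Longrightarrow> x i \<in> {1..n}" and "\<And>i. i \<notin> {1..n} \<Longrightarrow> x i = i"
  shows "conjugate n (conjugate n x) = x"
proof
  fix i
  show "conjugate n (conjugate n x) i = x i"
  proof (cases "i \<in> {1..n}")
    case True
    then have "n + 1 - i \<in> {1..n}" "n + 1 - (n + 1 - i) = i" by auto
    with True assms(1)[of i] show ?thesis by (simp add: conjugate_def)
  next
    case False
    then show ?thesis using assms(2)[of i] unfolding conjugate_def by simp
  qed
qed

lemma conjugate_permutes:
  assumes "y permutes {1..n}"
  shows "conjugate n y permutes {1..n}"
proof -
  define r where "r = (\<lambda>i. if i \<in> {1..n} then n + 1 - i else i)"
  have r: "r permutes {1..n}"
  proof (rule bij_imp_permutes)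
    show "bij_betw r {1..n} {1..n}"
      by (rule bij_betw_byWitness[where f' = r]) (auto simp: r_def)
  qed (auto simp: r_def)
  have "conjugate n y = r \<circ> y \<circ> r"
    using permutes_in_image[OF assms] permutes_not_in[OF assms]
    by (auto simp: conjugate_def r_def fun_eq_iff)
  then show ?thesis
    using permutes_compose[OF r permutes_compose[OF assms r]] by (simp add: comp_assoc)
qed

text \<open>
  Applying \<open>conjugate n\<close> forgets nothing here: the outcome of a parking function stays within the
  street, where conjugation is an involution.
\<close>

lemma conjugate_outcome_eq_iff:
  assumes "y permutes {1..n}" and "c \<in> {1..n} \<rightarrow> {1..n}"
  shows "map_option (conjugate n) (outcome n c) = Some y \<longleftrightarrow>
         outcome n c = Some (conjugate n y)"
proof
  assume "map_option (conjugate n) (outcome n c) = Some y"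
  then obtain z where z: "outcome n c = Some z" and y: "y = conjugate n z"
    by auto
  have park: "park c (\<lambda>_. n) n = Some z"
    using z by (simp add: outcome_def)
  have "z i \<in> {1..n}" if "i \<in> {1..n}" for i
  proof -
    have "c i \<le> z i" "z i \<le> n" "1 \<le> c i"
      using park that assms(2) unfolding park_eq_Some_iff by auto
    then show ?thesis by simp
  qed
  moreover have "z i = i" if "i \<notin> {1..n}" for i
    using park that unfolding park_eq_Some_iff by blast
  ultimately show "outcome n c = Some (conjugate n y)"
    using conjugate_conjugate[of n z] z y by simp
next
  assume "outcome n c = Some (conjugate n y)"
  moreover have "conjugate n (conjugate n y) = y"
    using permutes_in_image[OF assms(1)] permutes_not_in[OF assms(1)]
    by (intro conjugate_conjugate) auto
  ultimately show "map_option (conjugate n) (outcome n c) = Some y"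
    by simp
qed

lemma image_reverse_greaterThanAtMost:
  fixes i k n :: nat
  assumes "k \<le> n"
  shows "(\<lambda>s. n + 1 - s) ` {i<..k} = {n + 1 - k..<n + 1 - i}"
proof
  show "{n + 1 - k..<n + 1 - i} \<subseteq> (\<lambda>s. n + 1 - s) ` {i<..k}"
  proof
    fix t assume "t \<in> {n + 1 - k..<n + 1 - i}"
    then have "t = n + 1 - (n + 1 - t)" "n + 1 - t \<in> {i<..k}"
      using assms by auto
    then show "t \<in> (\<lambda>s. n + 1 - s) ` {i<..k}" by (rule image_eqI)
  qed
qed (use assms in auto)

text \<open>
  The reflection \<open>s \<mapsto> n + 1 - s\<close> of both the spots and the cars turns taking the lowest free spot,
  after the cars with smaller numbers, into taking the highest free spot, after the cars with larger
  numbers.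
\<close>

lemma conjugate_outcome_conjugate_eq_iff:
  assumes y: "y permutes {1..n}" and b: "b \<in> {1..n} \<rightarrow> {1..n}"
  shows "map_option (conjugate n) (outcome n (conjugate n b)) = Some y \<longleftrightarrow>
         (\<forall>i\<in>{1..n}. y i \<le> b i \<and> {y i<..b i} \<subseteq> y ` {i<..n})"
proof -
  let ?r = "\<lambda>s. n + 1 - s"
  let ?first = "\<lambda>j. conjugate n b j \<le> conjugate n y j \<and>
    {conjugate n b j..<conjugate n y j} \<subseteq> conjugate n y ` {1..<j}"
  have y_range: "y i \<in> {1..n}" if "i \<in> {1..n}" for i
    using permutes_in_image[OF y, of i] that by simp
  have "conjugate n b \<in> {1..n} \<rightarrow> {1..n}"
  proof
    fix i assume i: "i \<in> {1..n}"
    then have "n + 1 - i \<in> {1..n}" by auto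
    then have "b (n + 1 - i) \<in> {1..n}" by (rule funcset_mem[OF b])
    with i show "conjugate n b i \<in> {1..n}" by (auto simp: conjugate_def)
  qed
  then have "map_option (conjugate n) (outcome n (conjugate n b)) = Some y \<longleftrightarrow>
      (\<forall>j\<in>{1..n}. ?first j)"
    using conjugate_outcome_eq_iff[OF y] outcome_eq_Some_iff[OF conjugate_permutes[OF y]]
    by simp
  also have "\<dots> \<longleftrightarrow> (\<forall>i\<in>{1..n}. ?first (n + 1 - i))"
  proof
    assume "\<forall>j\<in>{1..n}. ?first j"
    moreover have "n + 1 - i \<in> {1..n}" if "i \<in> {1..n}" for i
      using that by auto
    ultimately show "\<forall>i\<in>{1..n}. ?first (n + 1 - i)" by blast
  next
    assume reversed: "\<forall>i\<in>{1..n}. ?first (n + 1 - i)"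
    show "\<forall>j\<in>{1..n}. ?first j"
    proof
      fix j assume "j \<in> {1..n}"
      then have "n + 1 - j \<in> {1..n}" "n + 1 - (n + 1 - j) = j" by auto
      with bspec[OF reversed, of "n + 1 - j"] show "?first j" by simp
    qed
  qed
  also have "\<dots> \<longleftrightarrow> (\<forall>i\<in>{1..n}. y i \<le> b i \<and> {y i<..b i} \<subseteq> y ` {i<..n})"
  proof (intro ball_cong refl)
    fix i assume i: "i \<in> {1..n}"
    have bi: "b i \<in> {1..n}" using b i by (auto simp: Pi_iff)
    have conj_i: "conjugate n z (n + 1 - i) = n + 1 - z i" for z
      using i by (auto simp: conjugate_def)
    have "conjugate n y ` {1..<n + 1 - i} = conjugate n y ` ?r ` {i<..n}"
      using image_reverse_greaterThanAtMost[of n n i] by simp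
    also have "\<dots> = ?r ` y ` {i<..n}"
      unfolding image_image by (intro image_cong) (auto simp: conjugate_def)
    finally have later: "conjugate n y ` {1..<n + 1 - i} = ?r ` y ` {i<..n}" .
    have "?r ` {y i<..b i} \<subseteq> ?r ` y ` {i<..n} \<longleftrightarrow> {y i<..b i} \<subseteq> y ` {i<..n}"
    proof -
      have inj: "inj_on ?r {1..n}" by (auto simp: inj_on_def)
      have "k \<in> {1..n}" if "k \<in> {i<..n}" for k
        using i that by auto
      then have sub: "y ` {i<..n} \<subseteq> {1..n}" using y_range by blast
      have "?r t \<in> ?r ` y ` {i<..n} \<longleftrightarrow> t \<in> y ` {i<..n}" if "t \<in> {y i<..b i}" for t
      proof -
        have "t \<in> {1..n}" using that bi by auto
        then show ?thesis by (rule inj_on_image_mem_iff[OF inj _ sub])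
      qed
      then show ?thesis
        unfolding image_subset_iff[of ?r "{y i<..b i}"] subset_eq[of "{y i<..b i}"]
        by (rule ball_cong[OF refl])
    qed
    moreover have "?r ` {y i<..b i} = {n + 1 - b i..<n + 1 - y i}"
      using bi by (intro image_reverse_greaterThanAtMost) simp
    moreover have "n + 1 - b i \<le> n + 1 - y i \<longleftrightarrow> y i \<le> b i"
      using bi y_range[OF i] by auto
    ultimately show "?first (n + 1 - i) \<longleftrightarrow> y i \<le> b i \<and> {y i<..b i} \<subseteq> y ` {i<..n}"
      unfolding conj_i later by simp
  qed
  finally show ?thesis .
qed

section \<open>Reachable pairs\<close>

theorem theorem5p2:
  fixes n :: nat and x y :: "nat \<Rightarrow> nat"
  assumes "n \<ge> 1"
    and "x permutes {1..n}"
    and "y permutes {1..n}"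
  shows "reachable n x y \<longleftrightarrow> (\<forall>i\<in>{1..n}. {y i..x i} \<subseteq> y ` {i..n})"
proof
  assume "reachable n x y"
  then obtain a b where ipf: "interval_parking_function n a b" "outcome n a = Some x"
    and y: "map_option (conjugate n) (outcome n (conjugate n b)) = Some y"
    by (auto simp: reachable_def)
  have a: "a \<in> {1..n} \<rightarrow> {1..n}" and b: "b \<in> {1..n} \<rightarrow> {1..n}"
    using ipf(1) by (auto simp: interval_parking_function_def)
  have x_le: "\<forall>i\<in>{1..n}. x i \<le> b i"
    using ipf interval_parking_function_with_outcome_iff[OF a b] by blast
  have above: "\<forall>i\<in>{1..n}. {y i<..b i} \<subseteq> y ` {i<..n}"
    using y conjugate_outcome_conjugate_eq_iff[OF assms(3) b] by blast
  show "\<forall>i\<in>{1..n}. {y i..x i} \<subseteq> y ` {i..n}"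
  proof (intro ballI subsetI)
    fix i s assume i: "i \<in> {1..n}" and s: "s \<in> {y i..x i}"
    show "s \<in> y ` {i..n}"
    proof (cases "s = y i")
      case True
      with i show ?thesis by auto
    next
      case False
      have "x i \<le> b i" using x_le i by blast
      with False s have "s \<in> {y i<..b i}" by auto
      with above i have "s \<in> y ` {i<..n}" by blast
      then show ?thesis by auto
    qed
  qed
next
  assume cond: "\<forall>i\<in>{1..n}. {y i..x i} \<subseteq> y ` {i..n}"
  define b where "b = (\<lambda>i. max (x i) (y i))"
  have x_range: "x \<in> {1..n} \<rightarrow> {1..n}"
    using permutes_in_image[OF assms(2)] by blast
  have y_range: "y \<in> {1..n} \<rightarrow> {1..n}"
    using permutes_in_image[OF assms(3)] by blast
  have b: "b \<in> {1..n} \<rightarrow> {1..n}"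
    using x_range y_range by (auto simp: b_def Pi_iff max_def)
  have "outcome n x = Some x"
    by (simp add: outcome_eq_Some_iff[OF assms(2)])
  then have "interval_parking_function n x b \<and> outcome n x = Some x"
    unfolding interval_parking_function_with_outcome_iff[OF x_range b] by (simp add: b_def)
  moreover have "{y i<..b i} \<subseteq> y ` {i<..n}" if i: "i \<in> {1..n}" for i
  proof
    fix s assume s: "s \<in> {y i<..b i}"
    \<comment> \<open>Such an \<open>s\<close> exists only if \<open>y i < x i\<close>, and then \<open>b i = x i\<close>.\<close>
    then have "s \<in> {y i..x i}" by (auto simp: b_def)
    with cond i obtain k where "k \<in> {i..n}" "s = y k" by blast
    moreover have "k \<noteq> i" using s \<open>s = y k\<close> by auto
    ultimately show "s \<in> y ` {i<..n}" by auto
  qed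
  then have "map_option (conjugate n) (outcome n (conjugate n b)) = Some y"
    unfolding conjugate_outcome_conjugate_eq_iff[OF assms(3) b] by (simp add: b_def)
  ultimately show "reachable n x y"
    by (auto simp: reachable_def)
qed

end
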